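(* Let $X$ be a finite set. 1. Let $f:2^X\to\mathbb{R}$ be a non-decreasing submodular function. Then $(X,\delta)$ given by $\delta(\emptyset)=0$ and $$\delta(A)=f(A)-\min\{f(\{a\}):a\in A\}\qquad(\emptyset\ne A\subseteq X)$$ is a submodular diversity. 2. Fix $x\in X$. Let $g:2^{X\setminus\{x\}}\to\mathbb{R}$ be a non-decreasing submodular function with $g(\emptyset)=0$. Then $(X,\widehat{\delta})$ given, for $A\subseteq X$, by $$\widehat{\delta}(A)=\begin{cases}g(A\setminus\{x\})&\text{if }x\in A;\\ g(A)-\min\{g(\{a\}):a\in A\}&\text{if }A\ne\emptyset\text{ and }x\notin A;\\ 0&\text{if }A=\emptyset,\end{cases}$$ is a submodular diversity.
   Context: A diversity is a pair $(X,\delta)$ where $X$ is a set and $\delta$ is a real-valued function on finite subsets of $X$ satisfying (D1') $\delta(A)=0$ if $|A|\le 1$, and (D2) $\delta(A\cup C)\le \delta(A\cup B)+\delta(B\cup C)$ for all finite $A,B,C\subseteq X$ with $B\neq\emptyset$. (So $\delta$ may vanish on sets with two or more elements.) Given (D1'), axiom (D2) is equivalent to: $\delta$ is non-decreasing ($A\subseteq B$ implies $\delta(A)\le\delta(B)$) and $\delta(A\cup B)\le\delta(A)+\delta(B)$ whenever $A\cap B\ne\emptyset$. A diversity $(X,\delta)$ is submodular if $\delta(A\cup B)+\delta(A\cap B)\le\delta(A)+\delta(B)$ for all $A,B$ with $A\cap B\neq\emptyset$. For a finite set $Z$, a function $f:2^Z\to\mathbb{R}$ is non-decreasing if $A\subseteq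 B$ implies $f(A)\le f(B)$, and submodular if $f(A\cup B)+f(A\cap B)\le f(A)+f(B)$ for all $A,B\subseteq Z$. *)

theory Defs
  imports Complex_Main
begin

text \<open>
  Functions on (finite) subsets of \<open>X\<close> are represented by total functions on sets, of which
  only the values on (finite) subsets of \<open>X\<close> matter.  The set \<open>X\<close> itself may be infinite and
  may be empty.  Note that \<open>\<delta>\<close> may vanish on sets with two or more elements.
\<close>

locale diversity =
  fixes X :: "'a set" and \<delta> :: "'a set \<Rightarrow> real"
  assumes D1: "\<And>A. A \<subseteq> X \<Longrightarrow> finite A \<Longrightarrow> card A \<le> 1 \<Longrightarrow> \<delta> A = 0"
    and D2: "\<And>A B C. A \<subseteq> X \<Longrightarrow> B \<subseteq> X \<Longrightarrow> C \<subseteq> X \<Longrightarrow> finite A \<Longrightarrow> finite B \<Longrightarrow> finite C \<Longrightarrow> B \<noteq> {} \<Longrightarrow>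
      \<delta> (A \<union> C) \<le> \<delta> (A \<union> B) + \<delta> (B \<union> C)"

text \<open>
  Submodularity of a diversity is only required for intersecting pairs, in contrast to
  submodularity of a set function below.
\<close>

locale submodular_diversity = diversity +
  assumes submodular: "\<And>A B. A \<subseteq> X \<Longrightarrow> B \<subseteq> X \<Longrightarrow> finite A \<Longrightarrow> finite B \<Longrightarrow> A \<inter> B \<noteq> {} \<Longrightarrow>
      \<delta> (A \<union> B) + \<delta> (A \<inter> B) \<le> \<delta> A + \<delta> B"

definition submodular_on :: "'a set \<Rightarrow> ('a set \<Rightarrow> real) \<Rightarrow> bool" where
  "submodular_on Z f \<longleftrightarrow> (\<forall>A B. A \<subseteq> Z \<longrightarrow> B \<subseteq> Z \<longrightarrow> f (A \<union> B) + f (A \<inter> B) \<le> f A + f B)"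

end

theory Submission
  imports Defs
begin

text \<open>
  Write \<open>m A = Min {f {a} | a. a \<in> A}\<close>, so that \<open>\<delta> = f - m\<close> on nonempty sets. Enlarging \<open>A\<close> raises
  \<open>f\<close> and lowers \<open>m\<close>, so \<open>\<delta>\<close> is non-decreasing. For intersecting \<open>A\<close> and \<open>B\<close> the number
  \<open>m (A \<union> B)\<close> is the smaller of \<open>m A\<close> and \<open>m B\<close>, while \<open>m (A \<inter> B)\<close> is at least the larger one;
  hence \<open>m (A \<union> B) + m (A \<inter> B) \<ge> m A + m B\<close>, and subtracting \<open>m\<close> preserves the submodularity
  of \<open>f\<close> on intersecting pairs. The triangle inequality follows from these two properties
  (\<open>submodular_diversityI\<close>).

  The second construction is the first one applied to \<open>f A = g (A - {x})\<close>: this \<open>f\<close> is again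
  non-decreasing and submodular, and \<open>f {x} = g {} = 0\<close> is the least value of \<open>f\<close> on subsets of \<open>X\<close>, so nothing is
  subtracted from sets containing \<open>x\<close>.
\<close>

text \<open>
  Axiom (D2) costs nothing for monotone set functions that are submodular on intersecting pairs:
  \<open>A \<union> B\<close> and \<open>B \<union> C\<close> share the nonempty set \<open>B\<close>, their union contains \<open>A \<union> C\<close>, and the term at
  their intersection is nonnegative and can be dropped.
\<close>

lemma submodular_diversityI:
  fixes \<delta> :: "'a set \<Rightarrow> real"
  assumes zero: "\<And>A. A \<subseteq> X \<Longrightarrow> finite A \<Longrightarrow> card A \<le> 1 \<Longrightarrow> \<delta> A = 0"
    and mono: "\<And>A B. A \<subseteq> B \<Longrightarrow> B \<subseteq> X \<Longrightarrow> finite B \<Longrightarrow> \<delta> A \<le> \<delta> B"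
    and submod: "\<And>A B. A \<subseteq> X \<Longrightarrow> B \<subseteq> X \<Longrightarrow> finite A \<Longrightarrow> finite B \<Longrightarrow> A \<inter> B \<noteq> {} \<Longrightarrow>
      \<delta> (A \<union> B) + \<delta> (A \<inter> B) \<le> \<delta> A + \<delta> B"
  shows "submodular_diversity X \<delta>"
proof
  fix A B C
  assume sub: "A \<subseteq> X" "B \<subseteq> X" "C \<subseteq> X" and fin: "finite A" "finite B" "finite C"
    and "B \<noteq> {}"
  let ?U = "(A \<union> B) \<union> (B \<union> C)" and ?I = "(A \<union> B) \<inter> (B \<union> C)"
  have "\<delta> ?U + \<delta> ?I \<le> \<delta> (A \<union> B) + \<delta> (B \<union> C)"
    using sub fin \<open>B \<noteq> {}\<close> by (intro submod) auto
  moreover have "\<delta> (A \<union> C) \<le> \<delta> ?U"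
    using sub fin by (intro mono) auto
  moreover have "\<delta> {} \<le> \<delta> ?I"
    using sub fin by (intro mono) auto
  moreover have "\<delta> {} = 0"
    by (simp add: zero)
  ultimately show "\<delta> (A \<union> C) \<le> \<delta> (A \<union> B) + \<delta> (B \<union> C)"
    by linarith
qed (use zero submod in auto)

lemma submodular_diversity_cong:
  assumes "submodular_diversity X \<delta>" and eq: "\<And>A. A \<subseteq> X \<Longrightarrow> finite A \<Longrightarrow> \<delta> A = \<delta>' A"
  shows "submodular_diversity X \<delta>'"
proof -
  interpret submodular_diversity X \<delta> by fact
  show ?thesis
  proof
    show "\<delta>' A = 0" if "A \<subseteq> X" "finite A" "card A \<le> 1" for A
      using D1[OF that] eq that by simp
    show "\<delta>' (A \<union> C) \<le> \<delta>' (A \<union> B) + \<delta>' (B \<union> C)"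
      if "A \<subseteq> X" "B \<subseteq> X" "C \<subseteq> X" "finite A" "finite B" "finite C" "B \<noteq> {}" for A B C
      using D2[OF that] that by (simp add: eq)
    show "\<delta>' (A \<union> B) + \<delta>' (A \<inter> B) \<le> \<delta>' A + \<delta>' B"
      if "A \<subseteq> X" "B \<subseteq> X" "finite A" "finite B" "A \<inter> B \<noteq> {}" for A B
      using submodular[OF that] that eq[of "A \<inter> B"] by (simp add: eq le_infI1)
  qed
qed

text \<open>
  The minimum over \<open>A \<union> B\<close> equals the smaller of the minima over \<open>A\<close> and \<open>B\<close>, and the larger one
  is at most the minimum over the subset \<open>A \<inter> B\<close>.
\<close>

lemma Min_image_supermodular:
  fixes w :: "'a \<Rightarrow> real"
  assumes "finite A" "finite B" "A \<inter> B \<noteq> {}"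
  shows "Min (w ` A) + Min (w ` B) \<le> Min (w ` (A \<union> B)) + Min (w ` (A \<inter> B))"
proof -
  have "Min (w ` (A \<union> B)) = min (Min (w ` A)) (Min (w ` B))"
    using assms by (simp add: image_Un) (rule Min_Un, auto)
  moreover have "Min (w ` A) \<le> Min (w ` (A \<inter> B))" "Min (w ` B) \<le> Min (w ` (A \<inter> B))"
    using assms by (intro Min_antimono; auto)+
  ultimately show ?thesis
    by linarith
qed

lemma submodular_diversity_diff_Min:
  fixes f :: "'a set \<Rightarrow> real"
  assumes mono: "mono_on (Pow X) f" and submod: "submodular_on X f"
  shows "submodular_diversity X (\<lambda>A. if A = {} then 0 else f A - Min {f {a} |a. a \<in> A})"
proof -
  let ?m = "\<lambda>A. Min ((\<lambda>a. f {a}) ` A)"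
  let ?\<delta> = "\<lambda>A. if A = {} then 0 else f A - ?m A"
  have f_mono: "f A \<le> f B" if "A \<subseteq> B" "B \<subseteq> X" for A B
    using that by (intro mono_onD[OF mono]) auto
  have "submodular_diversity X ?\<delta>"
  proof (rule submodular_diversityI)
    fix A :: "'a set" assume "finite A" "card A \<le> 1"
    then consider "A = {}" | a where "A = {a}"
      by (metis One_nat_def card_0_eq card_1_singletonE le_Suc_eq le_zero_eq)
    then show "?\<delta> A = 0"
      by cases auto
  next
    fix A B :: "'a set" assume AB: "A \<subseteq> B" "B \<subseteq> X" "finite B"
    show "?\<delta> A \<le> ?\<delta> B"
    proof (cases "A = {}")
      case True
      have "?m B \<le> f B" if b: "b \<in> B" for b
      proof -
        have "?m B \<le> f {b}"
          using AB b by (intro Min_le) auto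
        also have "\<dots> \<le> f B"
          using AB b by (intro f_mono) auto
        finally show ?thesis .
      qed
      with True show ?thesis
        by auto
    next
      case False
      then have "?m B \<le> ?m A"
        using AB by (intro Min_antimono) auto
      with f_mono[OF AB(1,2)] False AB show ?thesis
        by auto
    qed
  next
    fix A B :: "'a set"
    assume AB: "A \<subseteq> X" "B \<subseteq> X" "finite A" "finite B" "A \<inter> B \<noteq> {}"
    have "f (A \<union> B) + f (A \<inter> B) \<le> f A + f B"
      using submod AB unfolding submodular_on_def by blast
    with Min_image_supermodular[OF AB(3-5), of "\<lambda>a. f {a}"] AB(5)
    show "?\<delta> (A \<union> B) + ?\<delta> (A \<inter> B) \<le> ?\<delta> A + ?\<delta> B"
      by auto
  qed
  then show ?thesis
    unfolding setcompr_eq_image Collect_mem_eq .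
qed

lemma submodular_on_delete:
  assumes "submodular_on (X - {x}) g"
  shows "submodular_on X (\<lambda>A. g (A - {x}))"
  unfolding submodular_on_def
proof (intro allI impI)
  fix A B assume "A \<subseteq> X" "B \<subseteq> X"
  then have "A - {x} \<subseteq> X - {x}" "B - {x} \<subseteq> X - {x}"
    by auto
  then have "g ((A - {x}) \<union> (B - {x})) + g ((A - {x}) \<inter> (B - {x})) \<le> g (A - {x}) + g (B - {x})"
    using assms unfolding submodular_on_def by blast
  moreover have "(A - {x}) \<union> (B - {x}) = A \<union> B - {x}" "(A - {x}) \<inter> (B - {x}) = A \<inter> B - {x}"
    by auto
  ultimately show "g (A \<union> B - {x}) + g (A \<inter> B - {x}) \<le> g (A - {x}) + g (B - {x})"
    by simp
qed

lemma mono_on_delete: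
  assumes "mono_on (Pow (X - {x})) g"
  shows "mono_on (Pow X) (\<lambda>A. g (A - {x}))"
proof (rule mono_onI)
  fix A B assume "A \<in> Pow X" "B \<in> Pow X" "A \<subseteq> B"
  then show "g (A - {x}) \<le> g (B - {x})"
    by (intro mono_onD[OF assms]) auto
qed

lemma submodular_diversity_delete_diff_Min:
  fixes g :: "'a set \<Rightarrow> real"
  assumes mono: "mono_on (Pow (X - {x})) g"
    and submod: "submodular_on (X - {x}) g" and g0: "g {} = 0"
  shows "submodular_diversity X
    (\<lambda>A. if x \<in> A then g (A - {x})
         else if A \<noteq> {} then g A - Min {g {a} |a. a \<in> A}
         else 0)"
proof (rule submodular_diversity_cong)
  let ?f = "\<lambda>A. g (A - {x})"
  show "submodular_diversity X (\<lambda>A. if A = {} then 0 else ?f A - Min {?f {a} |a. a \<in> A})"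
    using mono submod
    by (intro submodular_diversity_diff_Min mono_on_delete submodular_on_delete)
  fix A assume A: "A \<subseteq> X" "finite A"
  show "(if A = {} then 0 else ?f A - Min {?f {a} |a. a \<in> A}) =
    (if x \<in> A then g (A - {x}) else if A \<noteq> {} then g A - Min {g {a} |a. a \<in> A} else 0)"
  proof (cases "x \<in> A")
    case True
    have "g {} \<le> ?f {a}" if "a \<in> A" for a
      using A that by (intro mono_onD[OF mono]) auto
    then have "Min ((\<lambda>a. ?f {a}) ` A) = 0"
      using True g0 A
      by (intro Min_eqI) (auto intro: image_eqI[of _ _ x])
    with True show ?thesis
      unfolding setcompr_eq_image by auto
  next
    case False
    then have "(\<lambda>a. ?f {a}) ` A = (\<lambda>a. g {a}) ` A"
      by (intro image_cong) (auto simp: insert_Diff_if)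
    with False show ?thesis
      unfolding setcompr_eq_image by simp
  qed
qed

theorem proposition10:
  fixes X :: "'a set"
  assumes "finite X"
  shows "(\<forall>f :: 'a set \<Rightarrow> real. mono_on (Pow X) f \<longrightarrow> submodular_on X f \<longrightarrow>
            submodular_diversity X
              (\<lambda>A. if A = {} then 0 else f A - Min {f {a} |a. a \<in> A})) \<and>
         (\<forall>x \<in> X. \<forall>g :: 'a set \<Rightarrow> real.
            mono_on (Pow (X - {x})) g \<longrightarrow> submodular_on (X - {x}) g \<longrightarrow> g {} = 0 \<longrightarrow>
            submodular_diversity X
              (\<lambda>A. if x \<in> A then g (A - {x})
                   else if A \<noteq> {} then g A - Min {g {a} |a. a \<in> A}
                   else 0))"
  by (intro conjI ballI allI impI submodular_diversity_diff_Min
      submodular_diversity_delete_diff_Min)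

end
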